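(* Let $\epsilon>0$ be such that $\mathcal{L}_\epsilon\neq\emptyset$, let $\mathbf{w}_0\in\Omega$, $\alpha>1$, and let $\epsilon_0>0$ satisfy $f(\mathbf{w}_0)-f_*\le\epsilon_0$. Run RSG$(\mathbf{w}_0,K,t,\alpha)$ with a positive integer $t\ge \frac{\alpha^2G^2}{\rho_\epsilon^2}$ and $K=\lceil\log_\alpha(\epsilon_0/\epsilon)\rceil$ (assumed to be a nonnegative integer). Then, with at most $K$ stages, RSG returns a solution $\mathbf{w}_K$ such that $f(\mathbf{w}_K)-f_*\le 2\epsilon$, and the total number of iterations (subgradient updates) used by RSG to find this $2\epsilon$-optimal solution is at most $T=t\lceil\log_\alpha(\epsilon_0/\epsilon)\rceil$.
   Context: Problem: $f:\mathbb{R}^d\to(-\infty,+\infty]$ is lower semicontinuous and convex, $\Omega\subseteq\mathrm{dom}(f)$ is a closed convex subset of $\mathbb{R}^d$, $f_*:=\min_{\mathbf{w}\in\Omega}f(\mathbf{w})$ is attained, and $\Omega_*\subseteq\Omega$ is the (nonempty) set of minimizers of $f$ over $\Omega$. No smoothness or strong convexity is assumed. Bounded subgradients: there is a constant $G>0$ such that for every $\mathbf{w}\in\Omega$ the subdifferential $\partial f(\mathbf{w})$ is nonempty and $\|\mathbf{v}\|_2\le G$ for all $\mathbf{v}\in\partial f(\mathbf{w})$. Level sets: $\mathcal{L}_\epsilon:=\{\mathbf{w}\in\Omega: f(\mathbf{w})=f_*+\epsilon\}$. $B_\epsilon:=\sup_{\mathbf{w}\in\mathcal{L}_\epsilon}\min_{\mathbf{u}\in\Omega_*}\|\mathbf{w}-\mathbf{u}\|_2$,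 which is assumed finite. $\mathcal{N}_\Omega(\mathbf{w})=\{\mathbf{v}\in\mathbb{R}^d:\mathbf{v}^\top(\mathbf{u}-\mathbf{w})\le0\ \forall\mathbf{u}\in\Omega\}$ is the normal cone. For $\epsilon>0$ with $\mathcal{L}_\epsilon\ne\emptyset$, $$\rho_\epsilon:=\inf_{\mathbf{w}\in\mathcal{L}_\epsilon}\ \inf_{\mathbf{g}\in\partial f(\mathbf{w}),\,\mathbf{v}\in\mathcal{N}_\Omega(\mathbf{w})}\|\mathbf{g}+\mathbf{v}\|_2 .$$ Algorithm RSG$(\mathbf{w}_0,K,t,\alpha)$ (given $\epsilon_0$ and $G$): for $k=1,\dots,K$ let $\eta_k=\epsilon_0/(\alpha^kG^2)$; set $\mathbf{x}_1=\mathbf{w}_{k-1}$ and, for $\tau=1,\dots,t$, $\mathbf{x}_{\tau+1}=\Pi_\Omega[\mathbf{x}_\tau-\eta_k\mathbf{g}_\tau]$, where $\mathbf{g}_\tau\in\partial f(\mathbf{x}_\tau)$ is an arbitrary subgradient returned by an oracle and $\Pi_\Omega$ is the Euclidean projection onto $\Omega$; set $\mathbf{w}_k=\frac1t\sum_{\tau=1}^t\mathbf{x}_\tau$. Output $\mathbf{w}_K$. Each $k$ is a stage; each $\tau$ within a stage is one iteration. *)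

theory Defs
  imports "HOL-Analysis.Analysis"
begin

definition lsc :: "('a::topological_space \<Rightarrow> ereal) \<Rightarrow> bool" where
  "lsc f \<longleftrightarrow> (\<forall>x. f x \<le> Liminf (at x) f)"

text \<open>
  Only meaningful for functions that never take the value \<open>-\<infinity>\<close>. At the endpoints of the
  segment the convention \<open>0 * \<infinity> = 0\<close> of \<^typ>\<open>ereal\<close> makes the inequality trivial.
\<close>
definition ereal_convex :: "('a::real_vector \<Rightarrow> ereal) \<Rightarrow> bool" where
  "ereal_convex f \<longleftrightarrow>
    (\<forall>x y. \<forall>u\<ge>0. \<forall>v\<ge>0. u + v = 1 \<longrightarrow>
       f (u *\<^sub>R x + v *\<^sub>R y) \<le> ereal u * f x + ereal v * f y)"

definition edom :: "('a \<Rightarrow> ereal) \<Rightarrow> 'a set" where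
  "edom f = {x. f x < \<infinity>}"

definition subdifferential :: "('a::real_inner \<Rightarrow> ereal) \<Rightarrow> 'a \<Rightarrow> 'a set" where
  "subdifferential f x = {g. \<forall>y. f y \<ge> f x + ereal (g \<bullet> (y - x))}"

definition normal_cone :: "'a::real_inner set \<Rightarrow> 'a \<Rightarrow> 'a set" where
  "normal_cone \<Omega> w = {v. \<forall>u\<in>\<Omega>. v \<bullet> (u - w) \<le> 0}"

definition opt_val :: "('a \<Rightarrow> ereal) \<Rightarrow> 'a set \<Rightarrow> ereal" where
  "opt_val f \<Omega> = (INF w\<in>\<Omega>. f w)"

definition opt_set :: "('a \<Rightarrow> ereal) \<Rightarrow> 'a set \<Rightarrow> 'a set" where
  "opt_set f \<Omega> = {w\<in>\<Omega>. f w = opt_val f \<Omega>}"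

definition level_set :: "('a \<Rightarrow> ereal) \<Rightarrow> 'a set \<Rightarrow> real \<Rightarrow> 'a set" where
  "level_set f \<Omega> \<epsilon> = {w\<in>\<Omega>. f w = opt_val f \<Omega> + ereal \<epsilon>}"

text \<open>
  The distance to the optimal set is a minimum whenever that set is closed and nonempty.
  The supremum is taken in \<^typ>\<open>ereal\<close>, so that its finiteness is a genuine condition.
\<close>
definition level_dist :: "('a::metric_space \<Rightarrow> ereal) \<Rightarrow> 'a set \<Rightarrow> real \<Rightarrow> ereal" where
  "level_dist f \<Omega> \<epsilon> = (SUP w\<in>level_set f \<Omega> \<epsilon>. ereal (infdist w (opt_set f \<Omega>)))"

text \<open>
  Real infima of norms; meaningful when the level set and the subdifferentials along it are
  nonempty (the normal cone at a point always contains \<open>0\<close>).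
\<close>
definition level_rho :: "('a::real_inner \<Rightarrow> ereal) \<Rightarrow> 'a set \<Rightarrow> real \<Rightarrow> real" where
  "level_rho f \<Omega> \<epsilon> =
    (INF w\<in>level_set f \<Omega> \<epsilon>.
       INF (g, v)\<in>subdifferential f w \<times> normal_cone \<Omega> w. norm (g + v))"

text \<open>
  An oracle answers the query for a subgradient at \<open>x\<close> made in iteration \<open>\<tau>\<close> of stage \<open>k\<close>.
  Its answer may depend on \<open>k\<close> and \<open>\<tau>\<close>, so quantifying over all oracles covers every sequence
  of subgradients that can be selected during a run.
\<close>
definition subgradient_oracle ::
    "('a::real_inner \<Rightarrow> ereal) \<Rightarrow> 'a set \<Rightarrow> (nat \<Rightarrow> nat \<Rightarrow> 'a \<Rightarrow> 'a) \<Rightarrow> bool" where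
  "subgradient_oracle f \<Omega> orc \<longleftrightarrow> (\<forall>k \<tau>. \<forall>x\<in>\<Omega>. orc k \<tau> x \<in> subdifferential f x)"

text \<open>
  One stage of projected subgradient steps: \<open>sg_state \<Omega> \<eta> gr x1 \<tau>\<close> is the pair of
  the iterate \<open>x\<^bsub>\<tau>+1\<^esub>\<close> and the number of subgradient updates performed to reach it.
\<close>
primrec sg_state ::
    "'a::euclidean_space set \<Rightarrow> real \<Rightarrow> (nat \<Rightarrow> 'a \<Rightarrow> 'a) \<Rightarrow> 'a \<Rightarrow> nat \<Rightarrow> 'a \<times> nat" where
  "sg_state \<Omega> \<eta> gr x1 0 = (x1, 0)"
| "sg_state \<Omega> \<eta> gr x1 (Suc \<tau>) =
    (case sg_state \<Omega> \<eta> gr x1 \<tau> of (x, n) \<Rightarrow>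
       (closest_point \<Omega> (x - \<eta> *\<^sub>R gr (Suc \<tau>) x), Suc n))"

definition sg_average ::
    "'a::euclidean_space set \<Rightarrow> real \<Rightarrow> (nat \<Rightarrow> 'a \<Rightarrow> 'a) \<Rightarrow> 'a \<Rightarrow> nat \<Rightarrow> 'a" where
  "sg_average \<Omega> \<eta> gr x1 t =
    (1 / real t) *\<^sub>R (\<Sum>\<tau>=1..t. fst (sg_state \<Omega> \<eta> gr x1 (\<tau> - 1)))"

record 'a rsg_result =
  solution :: 'a
  stages :: nat
  updates :: nat

primrec RSG ::
    "'a::euclidean_space set \<Rightarrow> real \<Rightarrow> real \<Rightarrow> (nat \<Rightarrow> nat \<Rightarrow> 'a \<Rightarrow> 'a) \<Rightarrow>
     'a \<Rightarrow> nat \<Rightarrow> nat \<Rightarrow> real \<Rightarrow> 'a rsg_result" where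
  "RSG \<Omega> G \<epsilon>0 orc w0 0 t \<alpha> = \<lparr>solution = w0, stages = 0, updates = 0\<rparr>"
| "RSG \<Omega> G \<epsilon>0 orc w0 (Suc k) t \<alpha> =
    (let r = RSG \<Omega> G \<epsilon>0 orc w0 k t \<alpha>;
         \<eta> = \<epsilon>0 / (\<alpha> ^ Suc k * G\<^sup>2)
     in \<lparr>solution = sg_average \<Omega> \<eta> (orc (Suc k)) (solution r) t,
         stages = Suc (stages r),
         updates = updates r + snd (sg_state \<Omega> \<eta> (orc (Suc k)) (solution r) t)\<rparr>)"

end

theory Submission
  imports Defs
begin

text \<open>
  Write \<open>m\<close> for the minimum of \<open>f\<close> over \<open>\<Omega>\<close> and \<open>\<rho>\<close> for \<open>level_rho f \<Omega> \<epsilon>\<close>. Averaged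
  subgradient steps started at \<open>x\<close> compete with every reference point \<open>u\<close> of \<open>\<Omega>\<close>: after \<open>t\<close>
  steps of size \<open>\<eta>\<close> the average exceeds \<open>f u\<close> by at most
  \<open>(norm (x - u))\<^sup>2 / (2 * \<eta> * t) + \<eta> * G\<^sup>2 / 2\<close> (\<open>sg_average_bound\<close>). The point of restarting is
  to compare not with a minimizer, which may be far away, but with a point of the \<open>\<epsilon>\<close>-sublevel
  set.

  Above that set \<open>f\<close> grows at least linearly, with rate \<open>\<rho>\<close>, in the distance to the set: this is
  the error bound \<open>sublevel_error_bound\<close>. Its core is the optimality condition for the projection
  \<open>z\<close> of \<open>w\<close> onto the sublevel set, which writes a nonnegative multiple of \<open>w - z\<close> as a
  subgradient of \<open>f\<close> plus a normal vector of \<open>\<Omega>\<close>. Two separations give it: one in the plane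
  provides the multiplier (\<open>sublevel_normal_multiplier\<close>), and one of the epigraph of \<open>f\<close> from a
  set over \<open>\<Omega>\<close> provides the two summands (\<open>subdifferential_plus_indicator\<close>). Finiteness of the
  distance from the level set to the minimizers makes \<open>\<rho>\<close> positive (\<open>level_rho_pos\<close>).

  Hence if the value at the start of a stage is at most \<open>m + \<epsilon> + e\<close>, some point of the sublevel
  set lies within \<open>e / \<rho>\<close>, and the stage ends with a value of at most \<open>m + \<epsilon> + e / \<alpha>\<close>
  (\<open>stage_contraction\<close>). The excess \<open>e\<close> starts at \<open>\<epsilon>0\<close> and after \<open>\<lceil>log \<alpha> (\<epsilon>0 / \<epsilon>)\<rceil>\<close> stages is
  at most \<open>\<epsilon>\<close>.
\<close>

section \<open>Convex functions with values in the extended reals\<close>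

lemma lsc_imp_closed_sublevel:
  fixes f :: "'a::topological_space \<Rightarrow> ereal"
  assumes "lsc f"
  shows "closed {x. f x \<le> c}"
proof -
  have "open {x. c < f x}"
  proof (subst open_subopen, intro ballI)
    fix x assume "x \<in> {x. c < f x}"
    then have x: "c < f x" by simp
    have "c < Liminf (at x) f"
      using x assms unfolding lsc_def by (meson less_le_trans)
    then have "eventually (\<lambda>y. c < f y) (at x)"
      by (rule less_LiminfD)
    then obtain S where "open S" "x \<in> S" "\<forall>y\<in>S. y \<noteq> x \<longrightarrow> c < f y"
      unfolding eventually_at_topological by blast
    then show "\<exists>T. open T \<and> x \<in> T \<and> T \<subseteq> {x. c < f x}"
      using x by (intro exI[of _ S]) auto
  qed
  moreover have "- {x. f x \<le> c} = {x. c < f x}"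
    by auto
  ultimately show ?thesis
    by (simp add: closed_def)
qed

lemma ereal_convex_imp_convex_on:
  fixes f :: "'a::real_vector \<Rightarrow> ereal"
  assumes "ereal_convex f" "convex S" "\<And>x. x \<in> S \<Longrightarrow> f x = ereal (F x)"
  shows "convex_on S F"
proof (rule convex_onI)
  fix t :: real and x y assume t: "0 < t" "t < 1" and xy: "x \<in> S" "y \<in> S"
  have "(1 - t) *\<^sub>R x + t *\<^sub>R y \<in> S"
    using assms(2) xy t by (intro convexD) auto
  moreover have "f ((1 - t) *\<^sub>R x + t *\<^sub>R y) \<le> ereal (1 - t) * f x + ereal t * f y"
    using assms(1) t unfolding ereal_convex_def by simp
  ultimately show "F ((1 - t) *\<^sub>R x + t *\<^sub>R y) \<le> (1 - t) * F x + t * F y"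
    using xy assms(3) by simp
qed (fact assms(2))

lemma convex_strict_epigraph:
  fixes f :: "'a::real_vector \<Rightarrow> ereal"
  assumes "ereal_convex f" "\<And>x. f x \<noteq> -\<infinity>"
  shows "convex {(x, r). f x < ereal r}"
proof (rule convexI, clarsimp)
  fix x y :: 'a and r s u v :: real
  assume *: "f x < ereal r" "f y < ereal s" "0 \<le> u" "0 \<le> v" "u + v = 1"
  obtain p q where pq: "f x = ereal p" "f y = ereal q"
    using *(1,2) assms(2)[of x] assms(2)[of y] by (cases "f x"; cases "f y") auto
  have "f (u *\<^sub>R x + v *\<^sub>R y) \<le> ereal u * f x + ereal v * f y"
    using assms(1) *(3-5) unfolding ereal_convex_def by blast
  moreover have "u * p + v * q < u * r + v * s"
  proof (cases "u = 0")
    case False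
    then show ?thesis using * pq
      by (intro add_less_le_mono mult_strict_left_mono mult_left_mono) auto
  qed (use * pq in auto)
  ultimately show "f (u *\<^sub>R x + v *\<^sub>R y) < ereal (u * r + v * s)"
    using pq by (metis ereal_less(2) le_less_trans less_ereal.simps(1) plus_ereal.simps(1)
        times_ereal.simps(1))
qed

section \<open>Multipliers by separation\<close>

text \<open>
  The slope \<open>p\<close> supports \<open>f + indicator \<Omega>\<close> at \<open>z\<close>, that is, the strict epigraph of \<open>f\<close> is
  disjoint from the part of \<open>\<Omega> \<times> \<real>\<close> below the graph of the affine function. A hyperplane
  separating the two splits \<open>p\<close> into its two summands. The usual constraint qualification
  (a point of \<open>\<Omega>\<close> interior to the domain of \<open>f\<close>) is replaced by boundedness of the
  subdifferential: a vertical hyperplane would give a nonzero normal vector of the domain at \<open>z\<close>,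
  and arbitrarily large multiples of it could be added to a subgradient.
\<close>
lemma subdifferential_plus_indicator:
  fixes f :: "'a::euclidean_space \<Rightarrow> ereal"
  assumes proper: "\<And>x. f x \<noteq> -\<infinity>" and conv: "ereal_convex f" and "convex \<Omega>"
    and z: "z \<in> \<Omega>" "f z = ereal c"
    and nonempty: "subdifferential f z \<noteq> {}"
    and bounded: "\<And>g. g \<in> subdifferential f z \<Longrightarrow> norm g \<le> G"
    and supp: "\<And>x. x \<in> \<Omega> \<Longrightarrow> ereal (c + p \<bullet> (x - z)) \<le> f x"
  obtains g v where "g \<in> subdifferential f z" "v \<in> normal_cone \<Omega> z" "p = g + v"
proof -
  define E where "E = {(x, r). f x < ereal r}"
  define H where "H = {(y, s). y \<in> \<Omega> \<and> s \<le> c + p \<bullet> (y - z)}"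
  have zH: "(z, c) \<in> H" using z by (simp add: H_def)
  have zE: "(z, r) \<in> E" if "r > c" for r using z that by (simp add: E_def)
  have "convex H"
  proof (rule convexI, clarsimp simp: H_def, intro conjI)
    fix x y :: 'a and r s u v :: real
    assume *: "x \<in> \<Omega>" "y \<in> \<Omega>" "r \<le> c + p \<bullet> (x - z)" "s \<le> c + p \<bullet> (y - z)"
      "0 \<le> u" "0 \<le> v" "u + v = 1"
    show "u *\<^sub>R x + v *\<^sub>R y \<in> \<Omega>"
      using * \<open>convex \<Omega>\<close> by (intro convexD)
    have "u * r + v * s \<le> u * (c + p \<bullet> (x - z)) + v * (c + p \<bullet> (y - z))"
      using * by (intro add_mono mult_left_mono)
    also have "\<dots> = (u + v) * c + p \<bullet> (u *\<^sub>R x + v *\<^sub>R y - (u + v) *\<^sub>R z)"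
      by (simp add: algebra_simps inner_simps)
    finally show "u * r + v * s \<le> c + p \<bullet> (u *\<^sub>R x + v *\<^sub>R y - z)"
      using * by simp
  qed
  moreover have "convex E"
    unfolding E_def by (rule convex_strict_epigraph[OF conv proper])
  moreover have "H \<inter> E = {}"
  proof -
    have False if "y \<in> \<Omega>" "s \<le> c + p \<bullet> (y - z)" "f y < ereal s" for y s
    proof -
      have "ereal (c + p \<bullet> (y - z)) < ereal s"
        using supp[OF that(1)] that(3) by (rule le_less_trans)
      then show False using that(2) by simp
    qed
    then show ?thesis by (auto simp: H_def E_def)
  qed
  ultimately obtain ab k where ab: "ab \<noteq> 0" "\<forall>q\<in>H. ab \<bullet> q \<le> k" "\<forall>q\<in>E. k \<le> ab \<bullet> q"
    using separating_hyperplane_sets[of H E] zH zE[of "c + 1"] by (metis empty_iff less_add_one)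
  obtain a b where "ab = (a, b)" by (cases ab)
  then have sepH: "a \<bullet> y + b * s \<le> k" if "(y, s) \<in> H" for y s
    using ab(2) that by force
  have sepE: "k \<le> a \<bullet> x + b * r" if "(x, r) \<in> E" for x r
    using ab(3) \<open>ab = (a, b)\<close> that by force
  have "b \<ge> 0"
    using sepH[OF zH] sepE[OF zE[of "c + 1"]] by (simp add: algebra_simps)
  have "b \<noteq> 0"
  proof
    assume "b = 0"
    then have "a \<noteq> 0" using ab \<open>ab = (a, b)\<close> by (simp add: zero_prod_def)
    obtain g0 where g0: "g0 \<in> subdifferential f z" using nonempty by blast
    have dom: "a \<bullet> (x - z) \<ge> 0" if "f x \<noteq> \<infinity>" for x
    proof -
      obtain r where "f x = ereal r" using \<open>f x \<noteq> \<infinity>\<close> proper[of x] by (cases "f x") auto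
      then have "(x, r + 1) \<in> E" by (simp add: E_def)
      then show ?thesis
        using sepE sepH[OF zH] \<open>b = 0\<close> by (force simp: inner_diff_right)
    qed
    define l where "l = (G + norm g0 + 1) / norm a"
    have "norm g0 \<le> G" using bounded g0 .
    then have "G \<ge> 0" using norm_ge_zero[of g0] by linarith
    then have "l \<ge> 0" by (simp add: l_def)
    have "g0 - l *\<^sub>R a \<in> subdifferential f z"
      unfolding subdifferential_def
    proof (clarify)
      fix x
      show "f z + ereal ((g0 - l *\<^sub>R a) \<bullet> (x - z)) \<le> f x"
      proof (cases "f x = \<infinity>")
        case False
        have "(g0 - l *\<^sub>R a) \<bullet> (x - z) \<le> g0 \<bullet> (x - z)"
          using dom[OF False] \<open>l \<ge> 0\<close> by (simp add: inner_diff_left)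
        then have "f z + ereal ((g0 - l *\<^sub>R a) \<bullet> (x - z)) \<le> f z + ereal (g0 \<bullet> (x - z))"
          by (intro add_left_mono) simp
        also have "\<dots> \<le> f x" using g0 by (simp add: subdifferential_def)
        finally show ?thesis .
      qed simp
    qed
    then have "norm (g0 - l *\<^sub>R a) \<le> G" by (rule bounded)
    moreover have "norm (l *\<^sub>R a) = G + norm g0 + 1"
      using \<open>G \<ge> 0\<close> \<open>a \<noteq> 0\<close> by (simp add: l_def)
    moreover have "norm (l *\<^sub>R a) \<le> norm (g0 - l *\<^sub>R a) + norm g0"
      using norm_triangle_sub[of "l *\<^sub>R a" g0] by (simp add: norm_minus_commute add.commute)
    ultimately show False by linarith
  qed
  with \<open>b \<ge> 0\<close> have "b > 0" by simp
  \<comment> \<open>Both sets come arbitrarily close to \<open>(z, c)\<close>, so the hyperplane passes through it.\<close>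
  have k: "k = a \<bullet> z + b * c"
  proof (rule antisym)
    have "(k - a \<bullet> z) / b \<le> r" if "r > c" for r
      using sepE[OF zE[OF that]] \<open>b > 0\<close> by (simp add: field_simps)
    then have "(k - a \<bullet> z) / b \<le> c" by (rule dense_ge)
    then show "k \<le> a \<bullet> z + b * c" using \<open>b > 0\<close> by (simp add: field_simps)
  qed (use sepH[OF zH] in simp)
  show thesis
  proof
    show "- (1 / b) *\<^sub>R a \<in> subdifferential f z"
      unfolding subdifferential_def
    proof (clarify)
      fix x
      show "f z + ereal ((- (1 / b) *\<^sub>R a) \<bullet> (x - z)) \<le> f x"
      proof (cases "f x")
        case (real r)
        have above: "a \<bullet> z + b * c - a \<bullet> x \<le> b * s" if "s > r" for s
          using sepE[of x s] k real that by (simp add: E_def)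
        have "(a \<bullet> z + b * c - a \<bullet> x) / b \<le> s" if "s > r" for s
          using above[OF that] \<open>b > 0\<close> by (simp add: pos_divide_le_eq mult.commute)
        then have "(a \<bullet> z + b * c - a \<bullet> x) / b \<le> r" by (rule dense_ge)
        then show ?thesis
          using real z \<open>b > 0\<close> by (simp add: field_simps inner_simps)
      qed (use proper in auto)
    qed
    show "p + (1 / b) *\<^sub>R a \<in> normal_cone \<Omega> z"
      unfolding normal_cone_def
    proof (clarify)
      fix y assume "y \<in> \<Omega>"
      then have "a \<bullet> y + b * (c + p \<bullet> (y - z)) \<le> a \<bullet> z + b * c"
        using sepH[of y "c + p \<bullet> (y - z)"] k by (simp add: H_def)
      moreover have "b * ((p + (1 / b) *\<^sub>R a) \<bullet> (y - z)) = b * (p \<bullet> (y - z)) + a \<bullet> (y - z)"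
        using \<open>b > 0\<close> by (simp add: inner_add_left distrib_left)
      ultimately have "b * ((p + (1 / b) *\<^sub>R a) \<bullet> (y - z)) \<le> 0"
        by (simp add: inner_diff_right algebra_simps)
      then show "(p + (1 / b) *\<^sub>R a) \<bullet> (y - z) \<le> 0"
        using \<open>b > 0\<close> by (simp add: mult_le_0_iff)
    qed
  qed simp
qed

text \<open>
  The convex set of all pairs \<open>(n \<bullet> (x - z), b)\<close> with \<open>b \<ge> F x - F z\<close> avoids the open quadrant
  of the plane to the right of and below the origin, and \<open>\<theta>\<close> is the slope of a line through
  the origin separating them. The point \<open>w\<close> rules out a vertical line.
\<close>
lemma sublevel_normal_multiplier:
  fixes F :: "'a::euclidean_space \<Rightarrow> real"
  assumes conv: "convex_on \<Omega> F" and z: "z \<in> \<Omega>" and w: "w \<in> \<Omega>" "n \<bullet> (w - z) > 0"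
    and normal: "\<And>x. x \<in> \<Omega> \<Longrightarrow> F x \<le> F z \<Longrightarrow> n \<bullet> (x - z) \<le> 0"
  obtains \<theta> where "\<theta> \<ge> 0" "\<And>x. x \<in> \<Omega> \<Longrightarrow> F z + \<theta> * (n \<bullet> (x - z)) \<le> F x"
proof -
  define A where "A = {(a, b). \<exists>x\<in>\<Omega>. a = n \<bullet> (x - z) \<and> F x - F z \<le> b}"
  define Q where "Q = {0::real<..} \<times> {..<0::real}"
  have "convex A"
  proof (rule convexI, clarsimp simp: A_def)
    fix x y and r s u v :: real
    assume *: "x \<in> \<Omega>" "y \<in> \<Omega>" "F x - F z \<le> r" "F y - F z \<le> s" "0 \<le> u" "0 \<le> v" "u + v = 1"
    show "\<exists>q\<in>\<Omega>. u * (n \<bullet> (x - z)) + v * (n \<bullet> (y - z)) = n \<bullet> (q - z) \<and>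
        F q - F z \<le> u * r + v * s"
    proof (intro bexI conjI)
      show "u *\<^sub>R x + v *\<^sub>R y \<in> \<Omega>"
        using conv * by (intro convexD) (auto simp: convex_on_def)
      have "u * (n \<bullet> (x - z)) + v * (n \<bullet> (y - z))
          = n \<bullet> (u *\<^sub>R x + v *\<^sub>R y - (u + v) *\<^sub>R z)"
        by (simp add: algebra_simps inner_simps)
      then show "u * (n \<bullet> (x - z)) + v * (n \<bullet> (y - z)) = n \<bullet> (u *\<^sub>R x + v *\<^sub>R y - z)"
        using * by simp
      have "F (u *\<^sub>R x + v *\<^sub>R y) \<le> u * F x + v * F y"
        using conv * by (auto simp: convex_on_def)
      also have "\<dots> = u * (F x - F z) + v * (F y - F z) + (u + v) * F z"
        by (simp add: algebra_simps)
      also have "\<dots> \<le> u * r + v * s + F z"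
        using * by (intro add_mono mult_left_mono) auto
      finally show "F (u *\<^sub>R x + v *\<^sub>R y) - F z \<le> u * r + v * s" by simp
    qed
  qed
  moreover have "convex Q" unfolding Q_def by (intro convex_Times) auto
  moreover have "A \<inter> Q = {}"
    using normal by (force simp: A_def Q_def)
  moreover have zero_A: "(0, 0) \<in> A" using z by (auto simp: A_def intro!: bexI[of _ z])
  moreover have "(1, -1) \<in> Q" by (simp add: Q_def)
  ultimately obtain pq k where pq: "pq \<noteq> 0" "\<forall>y\<in>A. pq \<bullet> y \<le> k" "\<forall>y\<in>Q. k \<le> pq \<bullet> y"
    using separating_hyperplane_sets[of A Q] by (metis empty_iff)
  obtain p q where pq_eq: "pq = (p, q)" by (cases pq)
  then have sepA: "p * a + q * b \<le> k" if "(a, b) \<in> A" for a b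
    using pq that by force
  have sepQ: "k \<le> p * a - q * b" if "a > 0" "b > 0" for a b
    using bspec[OF pq(3), of "(a, - b)"] that pq_eq by (simp add: Q_def)
  have "k \<ge> 0" using sepA[OF zero_A] by simp
  have closure: "k \<le> p * a - q * b" if "a \<ge> 0" "b \<ge> 0" for a b
  proof (rule field_le_epsilon)
    fix e :: real assume "e > 0"
    define d where "d = e / (\<bar>p\<bar> + \<bar>q\<bar> + 1)"
    have "d > 0" using \<open>e > 0\<close> by (simp add: d_def)
    have "k \<le> p * (a + d) - q * (b + d)"
      using sepQ[of "a + d" "b + d"] that \<open>d > 0\<close> by linarith
    moreover have "(p - q) * d \<le> (\<bar>p\<bar> + \<bar>q\<bar> + 1) * d"
      using \<open>d > 0\<close> by (intro mult_right_mono) auto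
    moreover have "(\<bar>p\<bar> + \<bar>q\<bar> + 1) * d = e" by (simp add: d_def)
    ultimately show "k \<le> p * a - q * b + e" by (simp add: algebra_simps)
  qed
  have "k \<le> 0" "p \<ge> 0" "q \<le> 0"
    using closure[of 0 0] closure[of 1 0] closure[of 0 1] \<open>k \<ge> 0\<close> by auto
  have ineq: "p * (n \<bullet> (x - z)) \<le> - q * (F x - F z)" if "x \<in> \<Omega>" for x
    using sepA[of "n \<bullet> (x - z)" "F x - F z"] that \<open>k \<le> 0\<close> by (force simp: A_def)
  have "q \<noteq> 0"
  proof
    assume "q = 0"
    then have "p * (n \<bullet> (w - z)) \<le> 0" using ineq[OF w(1)] by simp
    then have "p = 0" using w(2) \<open>p \<ge> 0\<close> by (simp add: mult_le_0_iff)
    then show False using \<open>q = 0\<close> pq(1) pq_eq by (simp add: zero_prod_def)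
  qed
  with \<open>q \<le> 0\<close> have "- q > 0" by simp
  show thesis
  proof
    show "p / - q \<ge> 0" using \<open>p \<ge> 0\<close> \<open>- q > 0\<close> by (intro divide_nonneg_pos)
    fix x assume "x \<in> \<Omega>"
    have "p * (n \<bullet> (x - z)) / - q \<le> F x - F z"
      using ineq[OF \<open>x \<in> \<Omega>\<close>] \<open>- q > 0\<close> by (subst pos_divide_le_eq) (auto simp: mult.commute)
    then show "F z + p / - q * (n \<bullet> (x - z)) \<le> F x" by simp
  qed
qed

section \<open>The growth constant of a level set\<close>

lemma zero_in_normal_cone: "0 \<in> normal_cone \<Omega> w"
  by (simp add: normal_cone_def)

lemma level_rho_le_norm:
  fixes f :: "'a::real_inner \<Rightarrow> ereal"
  assumes "w \<in> level_set f \<Omega> \<epsilon>" "g \<in> subdifferential f w" "v \<in> normal_cone \<Omega> w"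
    and nonempty: "\<And>w. w \<in> level_set f \<Omega> \<epsilon> \<Longrightarrow> subdifferential f w \<noteq> {}"
  shows "level_rho f \<Omega> \<epsilon> \<le> norm (g + v)"
proof -
  define D where "D w = subdifferential f w \<times> normal_cone \<Omega> w" for w
  define I where "I w = (INF (g, v)\<in>D w. norm (g + v))" for w
  have "0 \<le> I u" if "u \<in> level_set f \<Omega> \<epsilon>" for u
    unfolding I_def using nonempty[OF that] zero_in_normal_cone[of \<Omega> u]
    by (intro cINF_greatest) (auto simp: D_def)
  then have "level_rho f \<Omega> \<epsilon> \<le> I w"
    unfolding level_rho_def I_def[symmetric] D_def[symmetric] using assms(1)
    by (intro cINF_lower bdd_belowI[of _ 0]) auto
  also have "I w \<le> (case (g, v) of (g, v) \<Rightarrow> norm (g + v))"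
    unfolding I_def using assms(2,3)
    by (intro cINF_lower bdd_belowI[of _ 0]) (auto simp: D_def)
  finally show ?thesis by simp
qed

text \<open>
  Stepping from a point \<open>w\<close> of the level set to a minimizer \<open>u\<close> decreases \<open>f\<close> by \<open>\<epsilon>\<close>, so
  \<open>(g + v) \<bullet> (w - u) \<ge> \<epsilon>\<close> for every subgradient \<open>g\<close> and normal vector \<open>v\<close> at \<open>w\<close>. Hence
  \<open>\<epsilon> / norm (g + v)\<close> is a lower bound for the distance of \<open>w\<close> to the minimizers, which is
  bounded along the level set.
\<close>
lemma level_rho_pos:
  fixes f :: "'a::real_inner \<Rightarrow> ereal"
  assumes opt: "opt_set f \<Omega> \<noteq> {}" and fin: "opt_val f \<Omega> = ereal m" and "\<epsilon> > 0"
    and level: "level_set f \<Omega> \<epsilon> \<noteq> {}" and dist: "level_dist f \<Omega> \<epsilon> < \<infinity>"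
    and nonempty: "\<And>w. w \<in> level_set f \<Omega> \<epsilon> \<Longrightarrow> subdifferential f w \<noteq> {}"
  shows "level_rho f \<Omega> \<epsilon> > 0"
proof -
  obtain N :: nat where N: "level_dist f \<Omega> \<epsilon> < ereal (real N)"
    using dist less_PInf_Ex_of_nat by auto
  define B where "B = real N + 1"
  have "B > 0" by (simp add: B_def)
  have B: "infdist w (opt_set f \<Omega>) \<le> B" if "w \<in> level_set f \<Omega> \<epsilon>" for w
  proof -
    have "ereal (infdist w (opt_set f \<Omega>)) \<le> level_dist f \<Omega> \<epsilon>"
      unfolding level_dist_def using that by (rule SUP_upper)
    also have "\<dots> < ereal (real N)" by (rule N)
    finally show ?thesis by (simp add: B_def)
  qed
  have bound: "\<epsilon> / B \<le> norm (g + v)"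
    if w: "w \<in> level_set f \<Omega> \<epsilon>" and g: "g \<in> subdifferential f w" and v: "v \<in> normal_cone \<Omega> w"
    for w g v
  proof -
    have step: "\<epsilon> \<le> norm (g + v) * dist w u" if u: "u \<in> opt_set f \<Omega>" for u
    proof -
      have "ereal (m + \<epsilon>) + ereal (g \<bullet> (u - w)) \<le> ereal m"
      proof -
        have "f w + ereal (g \<bullet> (u - w)) \<le> f u" using g by (simp add: subdifferential_def)
        then show ?thesis using w u fin by (simp add: level_set_def opt_set_def)
      qed
      then have "\<epsilon> \<le> g \<bullet> (w - u)" by (simp add: inner_diff_right)
      moreover have "v \<bullet> (u - w) \<le> 0" using v u by (auto simp: normal_cone_def opt_set_def)
      ultimately have "\<epsilon> \<le> (g + v) \<bullet> (w - u)" by (simp add: inner_simps)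
      also have "\<dots> \<le> norm (g + v) * norm (w - u)" by (rule norm_cauchy_schwarz)
      finally show ?thesis by (simp add: dist_norm)
    qed
    obtain u where "u \<in> opt_set f \<Omega>" using opt by blast
    then have "norm (g + v) \<noteq> 0" using step[of u] \<open>\<epsilon> > 0\<close> by auto
    then have pos: "norm (g + v) > 0" by simp
    have "\<epsilon> / norm (g + v) \<le> infdist w (opt_set f \<Omega>)"
      unfolding infdist_notempty[OF opt]
      using step pos opt by (intro cINF_greatest) (auto simp: field_simps)
    also have "\<dots> \<le> B" using B w .
    finally show ?thesis using pos \<open>B > 0\<close> by (simp add: field_simps)
  qed
  have "\<epsilon> / B \<le> level_rho f \<Omega> \<epsilon>"
    unfolding level_rho_def
  proof (intro cINF_greatest level)
    fix w assume w: "w \<in> level_set f \<Omega> \<epsilon>"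
    then show "subdifferential f w \<times> normal_cone \<Omega> w \<noteq> {}"
      using nonempty zero_in_normal_cone[of \<Omega> w] by blast
  qed (use bound in auto)
  moreover have "\<epsilon> / B > 0" using \<open>\<epsilon> > 0\<close> \<open>B > 0\<close> by simp
  ultimately show ?thesis by linarith
qed

text \<open>
  A point \<open>w\<close> of the sublevel set serves as \<open>z\<close> itself. Otherwise let \<open>z\<close> be the projection of
  \<open>w\<close> onto that set. It lies on the level set, and \<open>w - z\<close> is normal to the sublevel set there,
  so some nonnegative multiple \<open>\<theta> *\<^sub>R (w - z)\<close> supports \<open>f\<close> on \<open>\<Omega>\<close> at \<open>z\<close> and is the sum of a
  subgradient and a normal vector of \<open>\<Omega>\<close>. The norm of such a sum is at least
  \<open>level_rho f \<Omega> \<epsilon>\<close>, while the support inequality at \<open>w\<close> bounds it by the slope of \<open>F\<close> from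
  \<open>z\<close> to \<open>w\<close>.
\<close>
lemma sublevel_error_bound:
  fixes f :: "'a::euclidean_space \<Rightarrow> ereal"
  assumes proper: "\<And>x. f x \<noteq> -\<infinity>" and "lsc f" and conv: "ereal_convex f"
    and \<Omega>: "closed \<Omega>" "convex \<Omega>"
    and F: "\<And>x. x \<in> \<Omega> \<Longrightarrow> f x = ereal (F x)"
    and nonempty: "\<And>x. x \<in> \<Omega> \<Longrightarrow> subdifferential f x \<noteq> {}"
    and bounded: "\<And>x g. x \<in> \<Omega> \<Longrightarrow> g \<in> subdifferential f x \<Longrightarrow> norm g \<le> G"
    and m: "opt_val f \<Omega> = ereal m"
    and level: "level_set f \<Omega> \<epsilon> \<noteq> {}"
    and w: "w \<in> \<Omega>"
  obtains z where "z \<in> \<Omega>" "F z \<le> m + \<epsilon>"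
    "level_rho f \<Omega> \<epsilon> * norm (w - z) \<le> max 0 (F w - (m + \<epsilon>))"
proof (cases "F w \<le> m + \<epsilon>")
  case True
  then show ?thesis using that[of w] w by simp
next
  case False
  define c where "c = m + \<epsilon>"
  define S where "S = \<Omega> \<inter> {x. f x \<le> ereal c}"
  have F_conv: "convex_on \<Omega> F"
    using ereal_convex_imp_convex_on[OF conv \<Omega>(2)] F .
  have S_eq: "x \<in> S \<longleftrightarrow> x \<in> \<Omega> \<and> F x \<le> c" for x
    using F by (auto simp: S_def)
  have "closed S"
    unfolding S_def using \<Omega>(1) lsc_imp_closed_sublevel[OF \<open>lsc f\<close>] by blast
  have "convex S"
  proof (rule convexI)
    fix x y and u v :: real
    assume *: "x \<in> S" "y \<in> S" "0 \<le> u" "0 \<le> v" "u + v = 1"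
    have "F (u *\<^sub>R x + v *\<^sub>R y) \<le> u * F x + v * F y"
      using F_conv * by (auto simp: convex_on_def S_eq)
    also have "\<dots> \<le> u * c + v * c"
      using * by (intro add_mono mult_left_mono) (auto simp: S_eq)
    also have "\<dots> = c" using *(5) by (simp flip: distrib_right)
    finally show "u *\<^sub>R x + v *\<^sub>R y \<in> S"
      using * convexD[OF \<Omega>(2)] by (simp add: S_eq)
  qed
  have "S \<noteq> {}"
  proof -
    obtain y where "y \<in> \<Omega>" "f y = ereal m + ereal \<epsilon>"
      using level m by (auto simp: level_set_def)
    then have "y \<in> S" by (simp add: S_def c_def)
    then show ?thesis by blast
  qed
  define z where "z = closest_point S w"
  have "z \<in> S" unfolding z_def using \<open>closed S\<close> \<open>S \<noteq> {}\<close> by (rule closest_point_in_set)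
  then have z: "z \<in> \<Omega>" "F z \<le> c" by (auto simp: S_eq)
  have "w \<noteq> z" using False z by (auto simp: c_def)
  have normal: "(w - z) \<bullet> (x - z) \<le> 0" if "x \<in> S" for x
    unfolding z_def using \<open>convex S\<close> \<open>closed S\<close> that by (rule closest_point_dot)
  have Fz: "F z = c"
  proof (rule ccontr)
    assume "F z \<noteq> c"
    with z have "F z < c" by simp
    have "c < F w" using False by (simp add: c_def)
    \<comment> \<open>The chord of \<open>F\<close> from \<open>z\<close> to \<open>w\<close> reaches the height \<open>c\<close> at parameter \<open>s\<close>.\<close>
    define s where "s = (c - F z) / (F w - F z)"
    have s: "0 < s" "s \<le> 1" using \<open>F z < c\<close> \<open>c < F w\<close> by (auto simp: s_def)
    have "F ((1 - s) *\<^sub>R z + s *\<^sub>R w) \<le> (1 - s) * F z + s * F w"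
      using F_conv s z w by (auto simp: convex_on_def)
    also have "\<dots> = F z + s * (F w - F z)" by (simp add: algebra_simps)
    also have "\<dots> = c" using \<open>F z < c\<close> \<open>c < F w\<close> by (simp add: s_def)
    finally have "(1 - s) *\<^sub>R z + s *\<^sub>R w \<in> S"
      using s z w \<Omega>(2) by (simp add: S_eq convexD)
    then have "(w - z) \<bullet> ((1 - s) *\<^sub>R z + s *\<^sub>R w - z) \<le> 0" by (rule normal)
    also have "(1 - s) *\<^sub>R z + s *\<^sub>R w - z = s *\<^sub>R (w - z)" by (simp add: algebra_simps)
    finally have "s * ((w - z) \<bullet> (w - z)) \<le> 0" by simp
    moreover have "s * ((w - z) \<bullet> (w - z)) > 0"
      using s \<open>w \<noteq> z\<close> by (intro mult_pos_pos) auto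
    ultimately show False by simp
  qed
  obtain \<theta> where \<theta>: "\<theta> \<ge> 0" "\<And>x. x \<in> \<Omega> \<Longrightarrow> F z + \<theta> * ((w - z) \<bullet> (x - z)) \<le> F x"
  proof (rule sublevel_normal_multiplier[OF F_conv z(1) w])
    show "(w - z) \<bullet> (w - z) > 0" using \<open>w \<noteq> z\<close> by simp
  qed (use normal Fz S_eq in auto)
  have "ereal (F z + (\<theta> *\<^sub>R (w - z)) \<bullet> (x - z)) \<le> f x" if "x \<in> \<Omega>" for x
    using \<theta>(2)[OF that] F[OF that] by simp
  then obtain g v where gv: "g \<in> subdifferential f z" "v \<in> normal_cone \<Omega> z"
    "\<theta> *\<^sub>R (w - z) = g + v"
    using subdifferential_plus_indicator[OF proper conv \<Omega>(2) z(1) F[OF z(1)]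
        nonempty[OF z(1)] bounded[OF z(1)]] by blast
  have "z \<in> level_set f \<Omega> \<epsilon>" using z F Fz m by (simp add: level_set_def c_def)
  then have "level_rho f \<Omega> \<epsilon> \<le> norm (g + v)"
    using gv nonempty by (intro level_rho_le_norm) (auto simp: level_set_def)
  also have "norm (g + v) = \<theta> * norm (w - z)" using \<theta>(1) by (simp flip: gv(3))
  finally have "level_rho f \<Omega> \<epsilon> * norm (w - z) \<le> \<theta> * norm (w - z) * norm (w - z)"
    by (intro mult_right_mono) auto
  also have "\<dots> = \<theta> * ((w - z) \<bullet> (w - z))"
    by (simp add: dot_square_norm power2_eq_square)
  also have "\<dots> \<le> F w - c" using \<theta>(2)[OF w] Fz by simp
  finally show ?thesis using that[of z] z by (auto simp: c_def)
qed

section \<open>Projected subgradient steps\<close>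

lemma fst_sg_state_Suc:
  "fst (sg_state \<Omega> \<eta> gr x1 (Suc n)) =
    closest_point \<Omega> (fst (sg_state \<Omega> \<eta> gr x1 n)
      - \<eta> *\<^sub>R gr (Suc n) (fst (sg_state \<Omega> \<eta> gr x1 n)))"
  by (simp add: case_prod_unfold)

lemma snd_sg_state: "snd (sg_state \<Omega> \<eta> gr x1 n) = n"
  by (induction n) (simp_all add: case_prod_unfold)

lemma sg_state_in:
  assumes "closed \<Omega>" "x1 \<in> \<Omega>"
  shows "fst (sg_state \<Omega> \<eta> gr x1 n) \<in> \<Omega>"
proof (cases n)
  case (Suc k)
  then show ?thesis
    unfolding Suc fst_sg_state_Suc using assms by (intro closest_point_in_set) auto
qed (use assms in simp)

lemma sg_average_eq_lessThan:
  "sg_average \<Omega> \<eta> gr x1 t = (\<Sum>n<t. (1 / real t) *\<^sub>R fst (sg_state \<Omega> \<eta> gr x1 n))"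
proof -
  have "(\<Sum>\<tau>=1..t. fst (sg_state \<Omega> \<eta> gr x1 (\<tau> - 1))) = (\<Sum>n<t. fst (sg_state \<Omega> \<eta> gr x1 n))"
    by (rule sum.reindex_bij_witness[of _ Suc "\<lambda>\<tau>. \<tau> - 1"]) auto
  then show ?thesis by (simp add: sg_average_def scaleR_sum_right)
qed

lemma sg_average_in:
  assumes "closed \<Omega>" "convex \<Omega>" "x1 \<in> \<Omega>" "t > 0"
  shows "sg_average \<Omega> \<eta> gr x1 t \<in> \<Omega>"
  unfolding sg_average_eq_lessThan
  using assms sg_state_in by (intro convex_sum) auto

text \<open>
  Projection onto \<open>\<Omega>\<close> does not increase the distance to \<open>u\<close>, so each step decreases the squared
  distance by at least \<open>2 * \<eta> * (F x - F u)\<close>, up to an error of \<open>\<eta>\<^sup>2 * G\<^sup>2\<close>.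
\<close>
lemma subgradient_telescope:
  fixes F :: "'a::euclidean_space \<Rightarrow> real"
  assumes \<Omega>: "closed \<Omega>" "convex \<Omega>" and "\<eta> \<ge> 0" and x1: "x1 \<in> \<Omega>" and u: "u \<in> \<Omega>"
    and subgrad: "\<And>\<tau> x. x \<in> \<Omega> \<Longrightarrow> F x - F u \<le> gr \<tau> x \<bullet> (x - u)"
    and bounded: "\<And>\<tau> x. x \<in> \<Omega> \<Longrightarrow> norm (gr \<tau> x) \<le> G"
  shows "(norm (fst (sg_state \<Omega> \<eta> gr x1 n) - u))\<^sup>2
      + 2 * \<eta> * (\<Sum>i<n. F (fst (sg_state \<Omega> \<eta> gr x1 i)) - F u)
    \<le> (norm (x1 - u))\<^sup>2 + real n * (\<eta>\<^sup>2 * G\<^sup>2)"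
proof (induction n)
  case (Suc n)
  define x where "x = fst (sg_state \<Omega> \<eta> gr x1 n)"
  define g where "g = gr (Suc n) x"
  define y where "y = closest_point \<Omega> (x - \<eta> *\<^sub>R g)"
  have x: "x \<in> \<Omega>" unfolding x_def using \<Omega>(1) x1 by (rule sg_state_in)
  have "dist y (closest_point \<Omega> u) \<le> dist (x - \<eta> *\<^sub>R g) u"
    unfolding y_def using \<Omega> u by (intro closest_point_lipschitz) auto
  then have "norm (y - u) \<le> norm ((x - u) - \<eta> *\<^sub>R g)"
    using u by (simp add: closest_point_self dist_norm algebra_simps)
  then have "(norm (y - u))\<^sup>2 \<le> (norm ((x - u) - \<eta> *\<^sub>R g))\<^sup>2"
    by (rule power_mono) simp
  also have "\<dots> = (norm (x - u))\<^sup>2 - 2 * \<eta> * (g \<bullet> (x - u)) + \<eta>\<^sup>2 * (norm g)\<^sup>2"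
    unfolding power2_norm_eq_inner
    by (simp add: algebra_simps inner_simps inner_commute power2_eq_square)
  also have "\<dots> \<le> (norm (x - u))\<^sup>2 - 2 * \<eta> * (F x - F u) + \<eta>\<^sup>2 * G\<^sup>2"
  proof (intro add_mono diff_mono mult_left_mono power_mono order_refl)
    show "F x - F u \<le> g \<bullet> (x - u)" unfolding g_def using x by (rule subgrad)
    show "norm g \<le> G" unfolding g_def using x by (rule bounded)
  qed (use \<open>\<eta> \<ge> 0\<close> in auto)
  finally show ?case
    using Suc.IH unfolding fst_sg_state_Suc
    unfolding x_def[symmetric] g_def[symmetric] y_def[symmetric]
    by (simp add: x_def[symmetric] algebra_simps)
qed simp

lemma sg_average_bound:
  fixes F :: "'a::euclidean_space \<Rightarrow> real"
  assumes \<Omega>: "closed \<Omega>" and conv: "convex_on \<Omega> F" and "\<eta> > 0" "t > 0"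
    and x1: "x1 \<in> \<Omega>" and u: "u \<in> \<Omega>"
    and subgrad: "\<And>\<tau> x. x \<in> \<Omega> \<Longrightarrow> F x - F u \<le> gr \<tau> x \<bullet> (x - u)"
    and bounded: "\<And>\<tau> x. x \<in> \<Omega> \<Longrightarrow> norm (gr \<tau> x) \<le> G"
  shows "F (sg_average \<Omega> \<eta> gr x1 t) - F u
    \<le> (norm (x1 - u))\<^sup>2 / (2 * \<eta> * real t) + \<eta> * G\<^sup>2 / 2"
proof -
  define x where "x n = fst (sg_state \<Omega> \<eta> gr x1 n)" for n
  have "convex \<Omega>" using conv by (simp add: convex_on_def)
  have "F (sg_average \<Omega> \<eta> gr x1 t) \<le> (\<Sum>n<t. (1 / real t) * F (x n))"
    unfolding sg_average_eq_lessThan x_def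
    using conv \<open>t > 0\<close> sg_state_in[OF \<Omega> x1] by (intro convex_on_sum) auto
  also have "\<dots> = (\<Sum>n<t. F (x n) - F u) / real t + F u"
    using \<open>t > 0\<close> by (simp add: sum_subtractf sum_divide_distrib diff_divide_distrib)
  finally have jensen: "F (sg_average \<Omega> \<eta> gr x1 t) - F u \<le> (\<Sum>n<t. F (x n) - F u) / real t"
    by simp
  have "(norm (x t - u))\<^sup>2 + 2 * \<eta> * (\<Sum>n<t. F (x n) - F u)
      \<le> (norm (x1 - u))\<^sup>2 + real t * (\<eta>\<^sup>2 * G\<^sup>2)"
    unfolding x_def
    using \<Omega> \<open>convex \<Omega>\<close> _ x1 u subgrad bounded
    by (rule subgradient_telescope) (use \<open>\<eta> > 0\<close> in auto)
  then have "2 * \<eta> * (\<Sum>n<t. F (x n) - F u) \<le> (norm (x1 - u))\<^sup>2 + real t * (\<eta>\<^sup>2 * G\<^sup>2)"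
    using zero_le_power2[of "norm (x t - u)"] by linarith
  then have "(\<Sum>n<t. F (x n) - F u) / real t
      \<le> ((norm (x1 - u))\<^sup>2 + real t * (\<eta>\<^sup>2 * G\<^sup>2)) / (2 * \<eta> * real t)"
    using \<open>\<eta> > 0\<close> \<open>t > 0\<close> by (simp add: field_simps)
  also have "\<dots> = (norm (x1 - u))\<^sup>2 / (2 * \<eta> * real t) + \<eta> * G\<^sup>2 / 2"
    using \<open>\<eta> > 0\<close> \<open>t > 0\<close> by (simp add: field_simps power2_eq_square)
  finally show ?thesis using jensen by linarith
qed

section \<open>The restarted method\<close>

lemma RSG_stages: "stages (RSG \<Omega> G \<epsilon>0 orc w0 k t \<alpha>) = k"
  by (induction k) (simp_all add: Let_def)

lemma RSG_updates: "updates (RSG \<Omega> G \<epsilon>0 orc w0 k t \<alpha>) = k * t"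
  by (induction k) (simp_all add: Let_def snd_sg_state)

text \<open>
  With \<open>e\<close> the accuracy before a stage and \<open>e / \<alpha>\<close> the one after it, the starting point is within
  \<open>e / \<rho>\<close> of the point \<open>z\<close> of the sublevel set. The step size \<open>e / (\<alpha> * G\<^sup>2)\<close> makes the second
  error term half of \<open>e / \<alpha>\<close>, and the lower bound on the number \<open>T\<close> of steps makes the first
  one at most that.
\<close>
lemma stage_contraction:
  fixes e \<alpha> G \<rho> d T :: real
  assumes "e > 0" "\<alpha> > 0" "G > 0" "\<rho> > 0" "T > 0"
    and d: "0 \<le> d" "\<rho> * d \<le> e" and T: "\<alpha>\<^sup>2 * G\<^sup>2 / \<rho>\<^sup>2 \<le> T"
  shows "d\<^sup>2 / (2 * (e / (\<alpha> * G\<^sup>2)) * T) + e / (\<alpha> * G\<^sup>2) * G\<^sup>2 / 2 \<le> e / \<alpha>"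
proof -
  have "(\<rho> * d)\<^sup>2 \<le> e\<^sup>2" using d \<open>\<rho> > 0\<close> by (intro power_mono) auto
  moreover have "\<alpha>\<^sup>2 * G\<^sup>2 \<le> T * \<rho>\<^sup>2" using T \<open>\<rho> > 0\<close> by (simp add: field_simps)
  ultimately have "(\<rho> * d)\<^sup>2 * (\<alpha>\<^sup>2 * G\<^sup>2) \<le> e\<^sup>2 * (T * \<rho>\<^sup>2)"
    using \<open>T > 0\<close> by (intro mult_mono[where b = "e\<^sup>2"]) auto
  then have "(d\<^sup>2 * \<alpha>\<^sup>2 * G\<^sup>2) * \<rho>\<^sup>2 \<le> (e\<^sup>2 * T) * \<rho>\<^sup>2"
    by (simp add: power_mult_distrib algebra_simps)
  then have *: "d\<^sup>2 * \<alpha>\<^sup>2 * G\<^sup>2 \<le> e\<^sup>2 * T" using \<open>\<rho> > 0\<close> by simp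
  have "d\<^sup>2 / (2 * (e / (\<alpha> * G\<^sup>2)) * T) = (d\<^sup>2 * \<alpha>\<^sup>2 * G\<^sup>2) / (2 * e * T * \<alpha>)"
    using assms by (simp add: field_simps power2_eq_square)
  also have "\<dots> \<le> (e\<^sup>2 * T) / (2 * e * T * \<alpha>)"
    using * assms by (intro divide_right_mono) auto
  also have "\<dots> = e / \<alpha> / 2" using assms by (simp add: field_simps power2_eq_square)
  finally have "d\<^sup>2 / (2 * (e / (\<alpha> * G\<^sup>2)) * T) \<le> e / \<alpha> / 2" .
  moreover have "e / (\<alpha> * G\<^sup>2) * G\<^sup>2 / 2 = e / \<alpha> / 2" using assms by simp
  ultimately show ?thesis by (metis add_mono field_sum_of_halves order_refl)
qed

theorem theorem3:
  fixes f :: "real ^ 'd \<Rightarrow> ereal"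
    and \<Omega> :: "(real ^ 'd) set"
    and w0 :: "real ^ 'd"
    and orc :: "nat \<Rightarrow> nat \<Rightarrow> real ^ 'd \<Rightarrow> real ^ 'd"
    and G \<epsilon> \<epsilon>0 \<alpha> :: real
    and t K :: nat
  assumes f_proper: "\<And>x. f x \<noteq> -\<infinity>"
    and f_lsc: "lsc f"
    and f_convex: "ereal_convex f"
    and \<Omega>_dom: "\<Omega> \<subseteq> edom f"
    and \<Omega>_closed: "closed \<Omega>"
    and \<Omega>_convex: "convex \<Omega>"
    and min_attained: "opt_set f \<Omega> \<noteq> {}"
    and G_pos: "G > 0"
    and subgrad_nonempty: "\<And>w. w \<in> \<Omega> \<Longrightarrow> subdifferential f w \<noteq> {}"
    and subgrad_bounded: "\<And>w v. w \<in> \<Omega> \<Longrightarrow> v \<in> subdifferential f w \<Longrightarrow> norm v \<le> G"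
    and \<epsilon>_pos: "\<epsilon> > 0"
    and level_nonempty: "level_set f \<Omega> \<epsilon> \<noteq> {}"
    and level_dist_finite: "level_dist f \<Omega> \<epsilon> < \<infinity>"
    and w0_in: "w0 \<in> \<Omega>"
    and \<alpha>_gt: "\<alpha> > 1"
    and \<epsilon>0_pos: "\<epsilon>0 > 0"
    and w0_gap: "f w0 - opt_val f \<Omega> \<le> ereal \<epsilon>0"
    and orc_valid: "subgradient_oracle f \<Omega> orc"
    and t_pos: "t > 0"
    and t_ge: "real t \<ge> \<alpha>\<^sup>2 * G\<^sup>2 / (level_rho f \<Omega> \<epsilon>)\<^sup>2"
    and K_eq: "int K = \<lceil>log \<alpha> (\<epsilon>0 / \<epsilon>)\<rceil>"
  shows "let r = RSG \<Omega> G \<epsilon>0 orc w0 K t \<alpha> in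
      stages r \<le> K \<and>
      solution r \<in> \<Omega> \<and>
      f (solution r) - opt_val f \<Omega> \<le> ereal (2 * \<epsilon>) \<and>
      int (updates r) \<le> int t * \<lceil>log \<alpha> (\<epsilon>0 / \<epsilon>)\<rceil>"
proof -
  define F where "F x = real_of_ereal (f x)" for x
  have F: "f x = ereal (F x)" if "x \<in> \<Omega>" for x
    using that \<Omega>_dom f_proper[of x] by (cases "f x") (auto simp: F_def edom_def)
  obtain u where "u \<in> \<Omega>" "f u = opt_val f \<Omega>" using min_attained by (auto simp: opt_set_def)
  then obtain m where m: "opt_val f \<Omega> = ereal m" using F by metis
  have F_conv: "convex_on \<Omega> F"
    using ereal_convex_imp_convex_on[OF f_convex \<Omega>_convex] F .
  define \<rho> where "\<rho> = level_rho f \<Omega> \<epsilon>"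
  have "\<rho> > 0"
    unfolding \<rho>_def
    using min_attained m \<epsilon>_pos level_nonempty level_dist_finite
    by (rule level_rho_pos) (use subgrad_nonempty in \<open>auto simp: level_set_def\<close>)
  define sol where "sol k = solution (RSG \<Omega> G \<epsilon>0 orc w0 k t \<alpha>)" for k
  have orc_subgrad: "orc k \<tau> x \<in> subdifferential f x" if "x \<in> \<Omega>" for k \<tau> x
    using orc_valid that by (simp add: subgradient_oracle_def)
  have main: "sol k \<in> \<Omega> \<and> F (sol k) \<le> m + \<epsilon> + \<epsilon>0 / \<alpha> ^ k" for k
  proof (induction k)
    case 0
    have "F w0 - m \<le> \<epsilon>0" using w0_gap F[OF w0_in] m by simp
    then show ?case using w0_in \<epsilon>_pos by (simp add: sol_def)
  next
    case (Suc k)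
    define e where "e = \<epsilon>0 / \<alpha> ^ k"
    have "e > 0" using \<epsilon>0_pos \<alpha>_gt by (simp add: e_def)
    have e_Suc: "\<epsilon>0 / \<alpha> ^ Suc k = e / \<alpha>" by (simp add: e_def field_simps)
    define \<eta> where "\<eta> = e / (\<alpha> * G\<^sup>2)"
    have "\<eta> > 0" using \<open>e > 0\<close> \<alpha>_gt G_pos by (simp add: \<eta>_def)
    have sol_Suc: "sol (Suc k) = sg_average \<Omega> \<eta> (orc (Suc k)) (sol k) t"
      by (simp add: sol_def Let_def \<eta>_def e_def field_simps)
    have IH: "sol k \<in> \<Omega>" "F (sol k) \<le> m + \<epsilon> + e" using Suc by (auto simp: e_def)
    obtain z where z: "z \<in> \<Omega>" "F z \<le> m + \<epsilon>"
      "\<rho> * norm (sol k - z) \<le> max 0 (F (sol k) - (m + \<epsilon>))"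
      unfolding \<rho>_def
      by (rule sublevel_error_bound[OF f_proper f_lsc f_convex \<Omega>_closed \<Omega>_convex F
          subgrad_nonempty subgrad_bounded m level_nonempty IH(1)])
    have "\<rho> * norm (sol k - z) \<le> e" using z(3) IH(2) \<open>e > 0\<close> by linarith
    have "F (sol (Suc k)) - F z \<le> (norm (sol k - z))\<^sup>2 / (2 * \<eta> * real t) + \<eta> * G\<^sup>2 / 2"
      unfolding sol_Suc
    proof (rule sg_average_bound[OF \<Omega>_closed F_conv \<open>\<eta> > 0\<close> t_pos IH(1) z(1)])
      fix \<tau> x assume x: "x \<in> \<Omega>"
      have "f x + ereal (orc (Suc k) \<tau> x \<bullet> (z - x)) \<le> f z"
        using orc_subgrad[OF x] by (simp add: subdifferential_def)
      then show "F x - F z \<le> orc (Suc k) \<tau> x \<bullet> (x - z)"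
        using F[OF x] F[OF z(1)] by (simp add: inner_diff_right)
      show "norm (orc (Suc k) \<tau> x) \<le> G" using x orc_subgrad[OF x] by (rule subgrad_bounded)
    qed
    also have "\<dots> \<le> e / \<alpha>"
      unfolding \<eta>_def
      using \<open>e > 0\<close> \<alpha>_gt G_pos \<open>\<rho> > 0\<close> t_pos \<open>\<rho> * norm (sol k - z) \<le> e\<close> t_ge
      by (intro stage_contraction[where \<rho> = \<rho>]) (auto simp: \<rho>_def)
    finally have "F (sol (Suc k)) \<le> m + \<epsilon> + \<epsilon>0 / \<alpha> ^ Suc k"
      using z(2) unfolding e_Suc by linarith
    moreover have "sol (Suc k) \<in> \<Omega>"
      unfolding sol_Suc using \<Omega>_closed \<Omega>_convex IH(1) t_pos by (rule sg_average_in)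
    ultimately show ?case by blast
  qed
  have "log \<alpha> (\<epsilon>0 / \<epsilon>) \<le> real K"
    using K_eq by (metis le_of_int_ceiling of_int_of_nat_eq)
  then have "\<epsilon>0 / \<epsilon> \<le> \<alpha> powr real K"
    using \<alpha>_gt \<epsilon>0_pos \<epsilon>_pos by (simp add: log_le_iff)
  then have "\<epsilon>0 / \<alpha> ^ K \<le> \<epsilon>"
    using \<alpha>_gt \<epsilon>_pos by (simp add: powr_realpow field_simps)
  then have "F (sol K) - m \<le> 2 * \<epsilon>" using main[of K] by linarith
  then have "f (sol K) - opt_val f \<Omega> \<le> ereal (2 * \<epsilon>)"
    using F main[of K] m by simp
  then show ?thesis
    using main[of K] K_eq
    by (simp add: Let_def RSG_stages RSG_updates sol_def flip: K_eq)
qed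

end
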